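(* Let $p$ be an odd prime such that $2$ is a primitive root modulo $p^2$, let $r\ge2$, and let $\mathcal{I}\subseteq\{0,1,\dots,p-1\}$ with $1\le|\mathcal{I}|\le(p-1)/2$. Let $(f(u))_{u\ge0}$ be the binary sequence of period $p^{r+1}$ with $f(u)=1$ if $u\bmod p^{r+1}\in\bigcup_{l\in\mathcal{I}}D_l$ and $f(u)=0$ otherwise. Then the $k$-error linear complexity over $\mathbb{F}_2$ of $(f(u))_{u\ge0}$ is as follows. If $|\mathcal{I}|$ is odd: $$LC_k^{\mathbb{F}_2}((f(u))_{u\ge0})=\begin{cases} p^{r+1}-p^r+p-1, & 0\le k<p^{r-1},\\ p^{r+1}-p^r+1, & p^{r-1}\le k<p^{r-1}(p-1),\\ p^{r+1}-p^r, & p^{r-1}(p-1)\le k<p^{r-1}(p-1)|\mathcal{I}| \text{ (when } |\mathcal{I}|>1),\\ 0, & k\ge p^{r-1}(p-1)|\mathcal{I}|.\end{cases}$$ If $|\mathcal{I}|$ is even: $$LC_k^{\mathbb{F}_2}((f(u))_{u\ge0})=\begin{cases} p^{r+1}-p^r, & 0\le k<p^{r-1}(p-1)|\mathcal{I}|,\\ 0, & k\ge p^{r-1}(p-1)|\mathcal{I}|.\end{cases}$$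
   Context: Let $\varphi$ be Euler's totient function. For $r\ge1$, $Q_r(u)$ is the unique integer with $0\le Q_r(u)<p^r$ and $Q_r(u)\equiv \frac{u^{\varphi(p^r)}-1}{p^r}\pmod{p^r}$ if $\gcd(u,p)=1$, and $Q_r(u)=0$ if $p\mid u$. Define $H_0=Q_1$ and for $r\ge2$ let $H_{r-1}(u)\in\{0,\dots,p-1\}$ with $H_{r-1}(u)\equiv (Q_r(u)-Q_{r-1}(u))/p^{r-1}\pmod p$ (well defined since $Q_r\equiv Q_{r-1}\pmod{p^{r-1}}$); it is the highest $p$-adic digit of $Q_r(u)$. For $0\le l<p$, $D_l=\{u:0\le u<p^{r+1},\ \gcd(u,p)=1,\ H_{r-1}(u)=l\}$. The linear complexity over $\mathbb{F}_2$ of a periodic binary sequence is the least order $L$ of a linear recurrence $s(u+L)=c_{L-1}s(u+L-1)+\dots+c_0s(u)$ ($u\ge0$, $c_i\in\mathbb{F}_2$, $c_0\neq 0$) it satisfies (0 for the zero sequence). For $k\ge0$, the $k$-error linear complexity $LC_k^{\mathbb{F}_2}$ of a $T$-periodic sequence is the smallest linear complexity obtainable by changing at most $k$ terms per period (changes repeated periodically). *)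

theory Defs
  imports "HOL-Number_Theory.Number_Theory" "HOL-Library.Z2"
begin

text \<open>
  For coprime \<open>u\<close> and prime \<open>p\<close>, \<open>p ^ r\<close> divides \<open>u ^ totient (p ^ r) - 1\<close> by Euler's theorem,
  so the integer division below is exact.
\<close>
definition euler_quotient :: "nat \<Rightarrow> nat \<Rightarrow> nat \<Rightarrow> int" where
  "euler_quotient p r u =
     (if coprime u p
      then ((int u ^ totient (p ^ r) - 1) div int p ^ r) mod int p ^ r
      else 0)"

text \<open>
  \<open>quotient_digit p (r - 1) u\<close> is the highest \<open>p\<close>-adic digit of \<open>euler_quotient p r u\<close>.
  For odd primes \<open>p\<close> the division is again exact, because the quotients for the exponents
  \<open>j + 2\<close> and \<open>j + 1\<close> are congruent modulo \<open>p ^ (j + 1)\<close>.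
\<close>
fun quotient_digit :: "nat \<Rightarrow> nat \<Rightarrow> nat \<Rightarrow> int" where
  "quotient_digit p 0 u = euler_quotient p 1 u"
| "quotient_digit p (Suc j) u =
     ((euler_quotient p (j + 2) u - euler_quotient p (j + 1) u) div int p ^ (j + 1)) mod int p"

definition digit_class :: "nat \<Rightarrow> nat \<Rightarrow> nat \<Rightarrow> nat set" where
  "digit_class p r l =
     {u. u < p ^ (r + 1) \<and> coprime u p \<and> quotient_digit p (r - 1) u = int l}"

definition class_seq :: "nat \<Rightarrow> nat \<Rightarrow> nat set \<Rightarrow> nat \<Rightarrow> bit" where
  "class_seq p r I u = (if u mod p ^ (r + 1) \<in> (\<Union>l\<in>I. digit_class p r l) then 1 else 0)"

text \<open>
  For \<open>L = 0\<close> the recurrence has no coefficients and says that \<open>s\<close> is the zero sequence; hence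
  the linear complexity of the zero sequence is \<open>0\<close>.
\<close>
definition satisfies_recurrence :: "(nat \<Rightarrow> 'a::field) \<Rightarrow> nat \<Rightarrow> bool" where
  "satisfies_recurrence s L \<longleftrightarrow>
     (\<exists>c :: nat \<Rightarrow> 'a. (L > 0 \<longrightarrow> c 0 \<noteq> 0) \<and> (\<forall>u. s (u + L) = (\<Sum>i<L. c i * s (u + i))))"

text \<open>
  A \<open>T\<close>-periodic sequence with \<open>T > 0\<close> satisfies the recurrence \<open>s (u + T) = s u\<close>, so the least
  order exists for every periodic sequence.
\<close>
definition linear_complexity :: "(nat \<Rightarrow> 'a::field) \<Rightarrow> nat" where
  "linear_complexity s = (LEAST L. satisfies_recurrence s L)"

definition error_linear_complexity :: "nat \<Rightarrow> nat \<Rightarrow> (nat \<Rightarrow> 'a::field) \<Rightarrow> nat" where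
  "error_linear_complexity T k s =
     (LEAST L. \<exists>t. (\<forall>u. t (u + T) = t u) \<and> card {u. u < T \<and> t u \<noteq> s u} \<le> k \<and>
                   L = linear_complexity t)"

end

theory Submission
  imports Defs "HOL-Computational_Algebra.Polynomial_Factorial"
begin

text \<open>
  Write \<open>\<Phi>\<close> for the polynomial \<open>1 + x^(p^r) + \<dots> + x^((p - 1) p^r)\<close>, acting on sequences by
  letting \<open>x\<close> be the shift. Since \<open>2\<close> is a primitive root modulo all powers of \<open>p\<close>, a nonconstant
  divisor of \<open>\<Phi>\<close> over \<open>GF(2)\<close> has full degree. Hence a sequence \<open>t\<close> of period \<open>p^(r + 1)\<close>
  which does not already have period \<open>p^r\<close> has complexity \<open>deg \<Phi>\<close> plus that of \<open>\<Phi> t\<close>, the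
  sequence of the sums of \<open>t\<close> over the columns \<open>{u + k p^r | k < p}\<close>; and if this last complexity is
  less than \<open>p - 1\<close>, then \<open>\<Phi> t\<close> is constant.

  By lifting the exponent, the digit \<open>H\<close> takes every value exactly once on each column with \<open>u\<close>
  coprime to \<open>p\<close>. So the given sequence has \<open>card I\<close> ones on each such column and none
  on the others. Making it \<open>p^r\<close>-periodic costs at least \<open>card I\<close> errors on every coprime column,
  while below that threshold only the column sums matter: they are the constant
  \<open>card I mod 2\<close> on coprime columns and \<open>0\<close> elsewhere, and changing one of them costs one error.
\<close>

section \<open>Powers of congruent integers modulo prime powers\<close>

text \<open>The sum is the cofactor of \<open>a - b\<close> in \<open>a ^ n - b ^ n\<close>. For
  \<open>n = p - 1\<close> the congruence shows that this cofactor is prime to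
  \<open>p\<close>.\<close>

lemma cong_sum_powers_mult_powers:
  fixes a b m :: int
  assumes "[a = b] (mod m)"
  shows "[(\<Sum>i<n. b ^ (n - Suc i) * a ^ i) = int n * b ^ (n - 1)] (mod m)"
proof -
  have "[(\<Sum>i<n. b ^ (n - Suc i) * a ^ i) = (\<Sum>i<n. b ^ (n - Suc i) * b ^ i)] (mod m)"
    by (intro cong_sum cong_mult cong_pow cong_refl assms)
  also have "(\<Sum>i<n. b ^ (n - Suc i) * b ^ i) = (\<Sum>i<n. b ^ (n - 1))"
    by (intro sum.cong refl) (simp flip: power_add)
  finally show ?thesis by simp
qed

text \<open>This is the core of lifting the exponent: the cofactor of \<open>a - b\<close> in
  \<open>a ^ p - b ^ p\<close> contains \<open>p\<close> exactly once. Writing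
  \<open>a = b + p d\<close> and expanding to first order modulo \<open>p ^ 2\<close>, the constant
  terms contribute \<open>p * b ^ (p - 1)\<close>, and the linear terms cancel modulo
  \<open>p ^ 2\<close>.\<close>

lemma sum_powers_prime_factor:
  fixes a b :: int
  assumes p: "prime p" "odd p" and "int p dvd a - b" "\<not> int p dvd b"
  obtains c where "(\<Sum>i<p. b ^ (p - Suc i) * a ^ i) = int p * c" "\<not> int p dvd c"
proof -
  obtain d where a: "a = b + int p * d" using assms by (metis dvdE add.commute diff_add_cancel)
  have pow: "[a ^ i = b ^ i + int i * int p * d * b ^ (i - 1)] (mod int p ^ 2)" for i
  proof (induction i)
    case (Suc i)
    have "[a ^ Suc i = (b + int p * d) * (b ^ i + int i * int p * d * b ^ (i - 1))] (mod int p ^ 2)"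
      using cong_mult[OF cong_refl[of a] Suc] by (simp add: a)
    also have "(b + int p * d) * (b ^ i + int i * int p * d * b ^ (i - 1)) =
        b ^ Suc i + int (Suc i) * int p * d * b ^ i + int p ^ 2 * (int i * d\<^sup>2 * b ^ (i - 1))"
      by (cases i) (simp_all add: algebra_simps power2_eq_square)
    also have "[\<dots> = b ^ Suc i + int (Suc i) * int p * d * b ^ i] (mod int p ^ 2)"
      by (simp add: cong_iff_dvd_diff)
    finally show ?case by simp
  qed simp
  \<comment> \<open>Oddness of \<open>p\<close> makes \<open>(p - 1) / 2\<close> an integer, so this
    sum supplies the second factor \<open>p\<close> that removes the linear terms.\<close>
  have gauss: "(\<Sum>i<p. int i) = int p * ((int p - 1) div 2)"
  proof -
    have "2 * (\<Sum>i<n. int i) = int n * (int n - 1)" for n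
      by (induction n) (auto simp: algebra_simps)
    from this[of p] show ?thesis using \<open>odd p\<close>
      by (auto elim!: oddE)
  qed
  have "[(\<Sum>i<p. b ^ (p - Suc i) * a ^ i) =
      (\<Sum>i<p. b ^ (p - Suc i) * (b ^ i + int i * int p * d * b ^ (i - 1)))] (mod int p ^ 2)"
    by (intro cong_sum cong_mult pow cong_refl)
  also have "(\<Sum>i<p. b ^ (p - Suc i) * (b ^ i + int i * int p * d * b ^ (i - 1))) =
      (\<Sum>i<p. b ^ (p - 1) + int i * (int p * d * b ^ (p - 2)))"
  proof (intro sum.cong refl)
    fix i assume "i \<in> {..<p}"
    then have "b ^ (p - Suc i) * b ^ i = b ^ (p - 1)" by (simp flip: power_add)
    moreover have "b ^ (p - Suc i) * b ^ (i - 1) = b ^ (p - 2)" if "i > 0"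
      using that \<open>i \<in> {..<p}\<close> by (simp flip: power_add) (simp add: numeral_2_eq_2)
    ultimately show "b ^ (p - Suc i) * (b ^ i + int i * int p * d * b ^ (i - 1)) =
      b ^ (p - 1) + int i * (int p * d * b ^ (p - 2))"
      by (cases "i = 0") (simp_all add: distrib_left mult.assoc mult.left_commute)
  qed
  also have "\<dots> = int p * b ^ (p - 1) + int p ^ 2 * ((int p - 1) div 2 * d * b ^ (p - 2))"
    by (simp add: sum.distrib gauss power2_eq_square flip: sum_distrib_right)
  also have "[\<dots> = int p * b ^ (p - 1)] (mod int p ^ 2)"
    by (simp add: cong_iff_dvd_diff)
  finally have "[int p * b ^ (p - 1) = (\<Sum>i<p. b ^ (p - Suc i) * a ^ i)] (mod int p ^ 2)"
    by (rule cong_sym)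
  then obtain e where e: "(\<Sum>i<p. b ^ (p - Suc i) * a ^ i) = int p * b ^ (p - 1) + int p ^ 2 * e"
    unfolding cong_iff_lin by blast
  have "\<not> int p dvd b ^ (p - 1)"
    using assms p(1) prime_dvd_power[of "int p" b "p - 1"] by fastforce
  then have "\<not> int p dvd b ^ (p - 1) + int p * e"
    by (simp add: dvd_add_left_iff)
  with e show ?thesis
    by (intro that[of "b ^ (p - 1) + int p * e"]) (simp_all add: algebra_simps power2_eq_square)
qed

lemma prime_power_dvd_power_prime_diff_iff:
  fixes a b :: int
  assumes p: "prime p" "odd p" and ab: "int p dvd a - b" "\<not> int p dvd b"
  shows "int p ^ Suc e dvd a ^ p - b ^ p \<longleftrightarrow> int p ^ e dvd a - b"
proof -
  obtain c where c: "(\<Sum>i<p. b ^ (p - Suc i) * a ^ i) = int p * c" "\<not> int p dvd c"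
    using sum_powers_prime_factor[OF p ab] .
  have "coprime (int p ^ e) c"
    using c(2) p(1) by (simp add: prime_imp_coprime coprime_power_left_iff)
  then have "int p ^ e dvd (a - b) * c \<longleftrightarrow> int p ^ e dvd a - b"
    by (rule coprime_dvd_mult_left_iff)
  moreover have "a ^ p - b ^ p = int p * ((a - b) * c)"
    unfolding power_diff_sumr2 c(1) by simp
  ultimately show ?thesis using p(1) by (auto simp: prime_gt_0_nat)
qed

lemma prime_power_dvd_power_power_diff_iff:
  fixes a b :: int
  assumes p: "prime p" "odd p" and ab: "int p dvd a - b" "\<not> int p dvd b"
  shows "int p ^ (e + j) dvd a ^ (p ^ j) - b ^ (p ^ j) \<longleftrightarrow> int p ^ e dvd a - b"
proof (induction j)
  case (Suc j)
  have "a - b dvd a ^ (p ^ j) - b ^ (p ^ j)"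
    by (simp add: power_diff_sumr2)
  then have "int p dvd a ^ (p ^ j) - b ^ (p ^ j)" using ab dvd_trans by blast
  moreover have "\<not> int p dvd b ^ (p ^ j)"
    using ab p(1) prime_dvd_power[of "int p"] by auto
  ultimately show ?case
    using prime_power_dvd_power_prime_diff_iff[OF p, of "a ^ (p ^ j)" "b ^ (p ^ j)" "e + j"] Suc
    by (simp add: mult.commute flip: power_mult)
qed simp

text \<open>The exponent is \<open>p ^ j * (p - 1)\<close>. The factor \<open>p - 1\<close> leaves
  the \<open>p\<close>-adic valuation of \<open>a - b\<close> unchanged, because the cofactor is
  congruent to \<open>(p - 1) * b ^ (p - 2)\<close>, which \<open>p\<close> does not divide. Each of
  the \<open>j\<close> factors \<open>p\<close> raises the valuation by one.\<close>

lemma prime_power_dvd_power_totient_diff_iff: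
  fixes a b :: int
  assumes p: "prime p" "odd p" and ab: "int p dvd a - b" "\<not> int p dvd b"
  shows "int p ^ (e + j) dvd a ^ totient (p ^ Suc j) - b ^ totient (p ^ Suc j) \<longleftrightarrow>
    int p ^ e dvd a - b"
proof -
  define c where "c = (\<Sum>i<p-1. b ^ (p - 1 - Suc i) * a ^ i)"
  have "[c = int (p - 1) * b ^ (p - 1 - 1)] (mod int p)"
    unfolding c_def using ab by (intro cong_sum_powers_mult_powers) (simp add: cong_iff_dvd_diff)
  moreover have "\<not> int p dvd int (p - 1) * b ^ (p - 1 - 1)"
  proof -
    have "\<not> int p dvd int (p - 1)"
      using prime_gt_1_nat[OF p(1)] by (auto simp del: of_nat_diff dest!: dvd_imp_le)
    then show ?thesis
      using ab p(1) prime_dvd_power[of "int p"] by (auto simp: prime_dvd_mult_iff)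
  qed
  ultimately have "\<not> int p dvd c"
    using cong_dvd_iff by blast
  then have coprime: "coprime (int p ^ e) c"
    using p(1) by (simp add: prime_imp_coprime coprime_power_left_iff)
  have diff: "a ^ (p - 1) - b ^ (p - 1) = (a - b) * c"
    by (simp add: c_def power_diff_sumr2)
  have "int p ^ (e + j) dvd (a ^ (p - 1)) ^ (p ^ j) - (b ^ (p - 1)) ^ (p ^ j) \<longleftrightarrow>
      int p ^ e dvd a ^ (p - 1) - b ^ (p - 1)"
    using ab p prime_dvd_power[of "int p"]
    by (intro prime_power_dvd_power_power_diff_iff) (auto simp: diff simp del: One_nat_def)
  also have "\<dots> \<longleftrightarrow> int p ^ e dvd a - b"
    unfolding diff using coprime by (rule coprime_dvd_mult_left_iff)
  finally show ?thesis
    by (simp only: totient_prime_power_Suc[OF p(1)] mult.commute[of "p ^ j"] power_mult)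
qed

text \<open>If \<open>e\<close> is the order modulo \<open>p\<close>, lifting the exponent gives
  \<open>g ^ (e * p) = 1\<close> modulo \<open>p ^ 2\<close>. Hence \<open>p * (p - 1)\<close>
  divides \<open>p * e\<close>, which forces \<open>e = p - 1\<close>.\<close>

lemma residue_primroot_prime_square_imp_prime:
  assumes p: "prime p" "odd p" and g: "residue_primroot (p ^ 2) g"
  shows "residue_primroot p g"
proof -
  have cop: "coprime p g" and ord_eq: "ord (p ^ 2) g = p * (p - 1)"
    using g p(1) by (auto simp: residue_primroot_def totient_prime_power)
  then have "\<not> p dvd g" using p(1) by (metis coprime_absorb_left not_prime_unit)
  have "g > 0" using \<open>\<not> p dvd g\<close> by (auto intro: gr0I)
  define e where "e = ord p g"
  have "[g ^ e = 1] (mod p)" unfolding e_def by (rule ord)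
  then have "int p ^ 1 dvd int g ^ e - 1"
    by (metis cong_iff_dvd_diff cong_int_iff of_nat_1 of_nat_power power_one_right)
  then have "int p ^ Suc 1 dvd (int g ^ e) ^ p - 1 ^ p"
    using p by (subst prime_power_dvd_power_prime_diff_iff) auto
  then have "[g ^ (e * p) = 1] (mod (p ^ 2))"
    by (simp flip: cong_int_iff add: cong_iff_dvd_diff power_mult numeral_2_eq_2)
  then have "p * (p - 1) dvd p * e"
    by (simp add: ord_divides' ord_eq mult.commute)
  then have "p - 1 dvd e" using p(1) by (simp add: prime_gt_0_nat)
  moreover have "e dvd p - 1"
    using order_divides_totient[OF cop] p(1) by (simp add: e_def totient_prime)
  ultimately show ?thesis
    using cop p(1) by (simp add: residue_primroot_def e_def totient_prime prime_gt_0_nat dvd_antisym)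
qed

text \<open>Since the order modulo \<open>p ^ 2\<close> is \<open>p * (p - 1)\<close>, the power
  \<open>g ^ (p - 1)\<close> is not 1 modulo \<open>p ^ 2\<close>. This is the criterion for a
  primitive root modulo \<open>p\<close> to remain one modulo all powers of
  \<open>p\<close>.\<close>

lemma residue_primroot_power_dvd_imp_le:
  assumes p: "prime p" "odd p" and g: "residue_primroot (p ^ 2) g"
    and "d > 0" "[g ^ d = 1] (mod p ^ Suc i)"
  shows "p ^ i * (p - 1) \<le> d"
proof -
  have primroot: "residue_primroot p g"
    using residue_primroot_prime_square_imp_prime[OF p g] .
  have "[g ^ (p - 1) \<noteq> 1] (mod p\<^sup>2)"
  proof
    assume "[g ^ (p - 1) = 1] (mod p\<^sup>2)"
    then have "p * (p - 1) dvd p - 1"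
      using g p(1) by (simp add: ord_divides residue_primroot_def totient_prime_power del: One_nat_def)
    then have "p * (p - 1) \<le> p - 1"
      using prime_gt_1_nat[OF p(1)] by (intro dvd_imp_le) auto
    then show False using prime_gt_1_nat[OF p(1)] by auto
  qed
  then have "residue_primroot (p ^ Suc i) g"
    using residue_primroot_prime_lift_iff[OF p primroot] by blast
  then have "ord (p ^ Suc i) g = p ^ i * (p - 1)"
    using totient_prime_power_Suc[OF p(1)] by (simp add: residue_primroot_def)
  then show ?thesis
    using assms by (auto simp: ord_divides' dest: dvd_imp_le)
qed

section \<open>Divisors of geometric polynomials\<close>

text \<open>The condition is put on coefficients rather than on the degree so that
  \<open>d = 0\<close> leaves the zero polynomial alone; nonzero constants have degree 0
  too.\<close>

lemma polys_degree_less_finite_card: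
  assumes "finite (UNIV :: 'a::zero set)"
  shows "finite {P :: 'a poly. \<forall>i\<ge>d. coeff P i = 0}"
    and "card {P :: 'a poly. \<forall>i\<ge>d. coeff P i = 0} = card (UNIV :: 'a set) ^ d"
proof -
  let ?S = "\<lambda>d. {P :: 'a poly. \<forall>i\<ge>d. coeff P i = 0}"
  have "finite (?S d) \<and> card (?S d) = card (UNIV :: 'a set) ^ d"
  proof (induction d)
    case 0
    have "?S 0 = {0}" by (auto simp: poly_eq_iff)
    then show ?case by simp
  next
    case (Suc d)
    have "?S (Suc d) = (\<lambda>(a, P). pCons a P) ` (UNIV \<times> ?S d)"
    proof (intro equalityI subsetI)
      fix P :: "'a poly" assume P: "P \<in> ?S (Suc d)"
      obtain a Q where "P = pCons a Q" by (cases P)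
      with P show "P \<in> (\<lambda>(a, P). pCons a P) ` (UNIV \<times> ?S d)"
        by (force dest: spec[of _ "Suc _"])
    qed (auto simp: coeff_pCons split: nat.splits)
    moreover have "inj_on (\<lambda>(a, P). pCons a P) (UNIV \<times> ?S d)"
      by (auto simp: inj_on_def)
    ultimately show ?case
      using Suc assms by (simp add: card_image card_cartesian_product)
  qed
  then show "finite (?S d)" "card (?S d) = card (UNIV :: 'a set) ^ d" by auto
qed

text \<open>
  Multiplication by \<open>x\<close> permutes the nonzero residues modulo \<open>q\<close>; compare the products of all
  residues before and after.
\<close>
lemma irreducible_dvd_monom_minus_1:
  fixes q :: "'a::field poly"
  assumes fin: "finite (UNIV :: 'a set)" and q: "irreducible q" "\<not> q dvd monom 1 1"
  shows "q dvd monom 1 (card (UNIV :: 'a set) ^ degree q - 1) - 1"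
proof -
  define x :: "'a poly" where "x = monom 1 1"
  define S where "S = {P :: 'a poly. \<forall>i\<ge>degree q. coeff P i = 0} - {0}"
  have prime: "prime_elem q" using q(1) by (rule field_poly_irreducible_imp_prime)
  have [simp]: "q \<noteq> 0" using q(1) by auto
  have S_iff: "P \<in> S \<longleftrightarrow> P \<noteq> 0 \<and> degree P < degree q" for P
  proof (cases "P = 0")
    case False
    then show ?thesis
      by (auto simp: S_def coeff_eq_0 not_le[symmetric])
  qed (simp add: S_def)
  have finS: "finite S" and cardS: "card S = card (UNIV :: 'a set) ^ degree q - 1"
    using polys_degree_less_finite_card[OF fin, of "degree q"] by (auto simp: S_def card_Diff_singleton)
  have not_dvd: "\<not> q dvd P" if "P \<in> S" for P
    using that dvd_imp_degree_le[of q P] by (auto simp: S_iff)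
  have inj: "inj_on (\<lambda>P. (x * P) mod q) S"
  proof (rule inj_onI)
    fix P Q assume PQ: "P \<in> S" "Q \<in> S" "(x * P) mod q = (x * Q) mod q"
    then have "q dvd x * (P - Q)" by (simp add: mod_eq_dvd_iff right_diff_distrib)
    then have "q dvd P - Q" using prime q(2) by (auto simp: prime_elem_dvd_mult_iff x_def)
    moreover have "P - Q \<in> S \<or> P = Q"
      using PQ by (auto simp: S_def)
    ultimately show "P = Q" using not_dvd by blast
  qed
  have into: "(\<lambda>P. (x * P) mod q) ` S \<subseteq> S"
  proof safe
    fix P assume P: "P \<in> S"
    then have "degree q > 0" by (auto simp: S_iff)
    have "\<not> q dvd x * P"
      using not_dvd[OF P] q(2) prime by (simp add: prime_elem_dvd_mult_iff x_def)
    then show "(x * P) mod q \<in> S"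
      using \<open>degree q > 0\<close> degree_mod_less'[of q "x * P"] by (simp add: S_iff mod_eq_0_iff_dvd)
  qed
  have bij: "bij_betw (\<lambda>P. (x * P) mod q) S S"
    using endo_inj_surj[OF finS into inj] inj by (simp add: bij_betw_def)
  have "\<Prod>S = (\<Prod>P\<in>S. (x * P) mod q)"
    using prod.reindex_bij_betw[OF bij, of "\<lambda>P. P"] by simp
  then have "\<Prod>S mod q = (\<Prod>P\<in>S. x * P) mod q"
    using mod_prod_eq[of "\<lambda>P. x * P" q S] by simp
  then have "q dvd (x ^ card S - 1) * \<Prod>S"
    by (simp add: prod.distrib mod_eq_dvd_iff left_diff_distrib dvd_diff_commute)
  moreover have "\<not> q dvd \<Prod>S"
    using finS not_dvd
  proof (induction S rule: finite_induct)
    case empty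
    then show ?case using irreducible_not_unit[OF q(1)] by simp
  next
    case (insert P F)
    then show ?case using prime by (auto simp: prime_elem_dvd_mult_iff)
  qed
  ultimately have "q dvd x ^ card S - 1"
    using prime by (auto simp: prime_elem_dvd_mult_iff)
  then show ?thesis by (simp add: cardS x_def monom_power)
qed

text \<open>If \<open>m * k = n * l + gcd m n\<close>, then \<open>x ^ gcd m n - 1\<close> is the
  difference of \<open>x ^ (m * k) - 1\<close> and \<open>x ^ gcd m n\<close> times
  \<open>x ^ (n * l) - 1\<close>.\<close>

lemma dvd_power_gcd_minus_1:
  fixes x q :: "'a::comm_ring_1"
  assumes "q dvd x ^ m - 1" "q dvd x ^ n - 1"
  shows "q dvd x ^ gcd m n - 1"
proof (cases "m = 0")
  case False
  then obtain k l where kl: "m * k = n * l + gcd m n" using bezout_nat by blast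
  have "q dvd x ^ (m * k) - 1" "q dvd x ^ (n * l) - 1"
    using assms power_diff_1_eq[of "x ^ m" k] power_diff_1_eq[of "x ^ n" l]
    by (simp_all add: power_mult)
  then have "q dvd (x ^ (m * k) - 1) - x ^ gcd m n * (x ^ (n * l) - 1)" by simp
  moreover have "(x ^ (m * k) - 1) - x ^ gcd m n * (x ^ (n * l) - 1) = x ^ gcd m n - 1"
    by (simp only: kl power_add) (simp add: right_diff_distrib mult.commute)
  ultimately show ?thesis by simp
qed (use assms in simp)

section \<open>Irreducible factors and the Euclidean algorithm for polynomials\<close>

lemma exists_irreducible_dvd_poly:
  fixes d :: "'a::field poly"
  assumes "degree d > 0"
  shows "\<exists>q. irreducible q \<and> q dvd d"
  using assms
proof (induction "degree d" arbitrary: d rule: less_induct)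
  case less
  show ?case
  proof (cases "irreducible d")
    case False
    have "d \<noteq> 0" using less.prems by auto
    then have "\<not> is_unit d" using less.prems by (simp add: is_unit_iff_degree)
    then obtain a b where ab: "d = a * b" "\<not> is_unit a" "\<not> is_unit b"
      using False \<open>d \<noteq> 0\<close> unfolding irreducible_def by blast
    with less.prems have nz: "a \<noteq> 0" "b \<noteq> 0" by auto
    then have "degree a > 0" "degree b > 0"
      using ab by (auto simp: is_unit_iff_degree)
    moreover have "degree d = degree a + degree b"
      using ab(1) nz by (simp add: degree_mult_eq)
    ultimately show ?thesis
      using less.hyps[of a] ab(1) by (auto intro: dvd_mult2)
  qed auto
qed

lemma poly_bezout:
  fixes a b :: "'a::field poly"
  obtains d u v where "d dvd a" "d dvd b" "d = u * a + v * b"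
proof -
  have "\<exists>d u v. d dvd a \<and> d dvd b \<and> d = u * a + v * b"
  \<comment> \<open>The measure must separate \<open>b = 0\<close> from a nonzero constant, since
    both have degree 0 and the Euclidean algorithm may pass from the latter to the former.\<close>
  proof (induction "if b = 0 then 0 else Suc (degree b)" arbitrary: a b rule: less_induct)
    case less
    show ?case
    proof (cases "b = 0")
      case True
      then have "a dvd a \<and> a dvd b \<and> a = 1 * a + 0 * b" by simp
      then show ?thesis by blast
    next
      case False
      then have "\<exists>d u v. d dvd b \<and> d dvd a mod b \<and> d = u * b + v * (a mod b)"
        using degree_mod_less[of b a] by (intro less.hyps) auto
      then obtain d u v where d: "d dvd b" "d dvd a mod b" "d = u * b + v * (a mod b)"
        by blast
      have "d = v * a + (u - v * (a div b)) * b"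
        by (subst d(3)) (simp add: minus_div_mult_eq_mod[symmetric] algebra_simps)
      then show ?thesis using d by (metis dvd_mod_iff)
    qed
  qed
  then show ?thesis using that by blast
qed

text \<open>This is the quotient of \<open>x ^ (m * n) - 1\<close> by \<open>x ^ m - 1\<close>. For
  \<open>m = p ^ r\<close> and \<open>n = p\<close> with \<open>p\<close> prime it is the cyclotomic
  polynomial of order \<open>p ^ (r + 1)\<close>.\<close>

definition geometric_poly :: "nat \<Rightarrow> nat \<Rightarrow> 'a::comm_ring_1 poly" where
  "geometric_poly m n = (\<Sum>k<n. monom 1 m ^ k)"

lemma geometric_poly_mult:
  "(monom 1 m - 1) * geometric_poly m n = (monom 1 (m * n) - 1 :: 'a::comm_ring_1 poly)"
  using power_diff_1_eq[of "monom (1::'a) m" n] by (simp add: geometric_poly_def monom_power mult.commute)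

lemma degree_monom_minus_1:
  assumes "n > 0"
  shows "degree (monom 1 n - 1 :: 'a::comm_ring_1 poly) = n"
  using assms degree_add_eq_left[of "-1" "monom (1::'a) n"] by (simp add: degree_monom_eq)

lemma degree_geometric_poly:
  assumes "m > 0" "n > 0"
  shows "degree (geometric_poly m n :: 'a::idom poly) = m * (n - 1)"
    and "geometric_poly m n \<noteq> (0 :: 'a poly)"
proof -
  have nz: "monom 1 k - 1 \<noteq> (0 :: 'a poly)" if "k > 0" for k
    using degree_monom_minus_1[OF that, where ?'a = 'a] that by auto
  show *: "geometric_poly m n \<noteq> (0 :: 'a poly)"
    using geometric_poly_mult[of m n, where ?'a = 'a] nz[of "m * n"] assms by auto
  have "m + degree (geometric_poly m n :: 'a poly) = m * n"
    using arg_cong[OF geometric_poly_mult[of m n, where ?'a = 'a], of degree] nz[of m] * assms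
    by (simp add: degree_mult_eq degree_monom_minus_1)
  then show "degree (geometric_poly m n :: 'a poly) = m * (n - 1)"
    using assms by (cases n) auto
qed

text \<open>Modulo \<open>x ^ m - 1\<close> every summand of the geometric polynomial is 1. Over
  GF(2) with \<open>n\<close> odd this means that the two polynomials share no factor except
  units.\<close>

lemma dvd_geometric_poly_imp_dvd_of_nat:
  fixes q :: "'a::comm_ring_1 poly"
  assumes "q dvd monom 1 m - 1" "q dvd geometric_poly m n"
  shows "q dvd of_nat n"
proof -
  have "geometric_poly m n - of_nat n = (\<Sum>k<n. monom 1 m ^ k - (1 :: 'a poly))"
    by (simp add: geometric_poly_def sum_subtractf)
  also have "q dvd \<dots>"
    using assms(1) by (intro dvd_sum) (simp add: power_diff_1_eq)
  finally show ?thesis using assms(2) by (metis dvd_diff_right_iff dvd_diff_commute)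
qed

lemma of_nat_bit: "(of_nat n :: bit) = of_bool (odd n)"
  by (induction n) auto

text \<open>Let \<open>q\<close> be an irreducible factor of \<open>d\<close>. In GF(2)[x]/(q) the
  order of \<open>x\<close> divides both \<open>p ^ (i + c)\<close> and
  \<open>2 ^ degree q - 1\<close>, but not \<open>p ^ i\<close>. Hence \<open>p ^ (i + 1)\<close>
  divides \<open>2 ^ degree q - 1\<close>, and the order of 2 bounds \<open>degree q\<close> from
  below. The two uses are \<open>c = 1\<close>, where the polynomial is \<Phi>, and
  \<open>i = 0\<close>, where it is the quotient of \<open>x ^ (p ^ c) - 1\<close> by
  \<open>x - 1\<close>.\<close>

lemma dvd_geometric_poly_bit_imp_degree_ge:
  fixes d :: "bit poly"
  assumes p: "prime p" "odd p" and g: "residue_primroot (p ^ 2) 2"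
    and d: "d dvd geometric_poly (p ^ i) (p ^ c)" "degree d > 0"
  shows "p ^ i * (p - 1) \<le> degree d"
proof -
  obtain q where q: "irreducible q" "q dvd d"
    using exists_irreducible_dvd_poly[OF d(2)] by blast
  have [simp]: "d \<noteq> 0" "q \<noteq> 0" using d(2) q by auto
  have not_unit: "\<not> q dvd 1" using q(1) by (rule irreducible_not_unit)
  have q_geo: "q dvd geometric_poly (p ^ i) (p ^ c)" using q(2) d(1) dvd_trans by blast
  have "of_nat (p ^ c) = (1 :: bit poly)"
    using p(2) by (simp add: of_nat_poly of_nat_bit del: of_nat_power)
  then have not_small: "\<not> q dvd monom 1 (p ^ i) - 1"
    using dvd_geometric_poly_imp_dvd_of_nat[of q "p ^ i" "p ^ c"] q_geo not_unit by auto
  have q_top: "q dvd monom 1 1 ^ (p ^ i * p ^ c) - 1"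
    using q_geo by (simp add: monom_power flip: geometric_poly_mult)
  have "\<not> q dvd monom 1 1"
  proof
    assume *: "q dvd monom 1 1"
    then have "q dvd monom 1 1 ^ (p ^ i * p ^ c)"
      using p(1) by (intro dvd_trans[OF * dvd_power]) (auto simp: prime_gt_0_nat)
    then show False using q_top not_unit by (metis dvd_diff_right_iff)
  qed
  moreover have UNIV_bit: "(UNIV :: bit set) = {0, 1}" by auto
  have "finite (UNIV :: bit set) \<and> card (UNIV :: bit set) = 2" unfolding UNIV_bit by simp
  ultimately have "q dvd monom 1 1 ^ (2 ^ degree q - 1) - 1"
    using irreducible_dvd_monom_minus_1[of q] q(1) by (simp add: monom_power)
  with q_top have "q dvd monom 1 1 ^ gcd (p ^ i * p ^ c) (2 ^ degree q - 1) - 1"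
    by (intro dvd_power_gcd_minus_1)
  moreover obtain a where a: "gcd (p ^ i * p ^ c) (2 ^ degree q - 1) = p ^ a"
    using divides_primepow_nat[OF p(1), of _ "i + c"] by (metis gcd_dvd1 power_add)
  ultimately have q_a: "q dvd monom 1 (p ^ a) - 1" by (simp add: monom_power)
  \<comment> \<open>For \<open>a\<close> at most \<open>i\<close>, \<open>x ^ (p ^ a) - 1\<close>
    divides \<open>x ^ (p ^ i) - 1\<close>, and \<open>q\<close> would divide the latter, contrary
    to \<open>not_small\<close>.\<close>
  have "\<not> a \<le> i"
  proof
    assume "a \<le> i"
    then have "monom 1 (p ^ i) - 1 = (monom 1 (p ^ a) - 1) * (geometric_poly (p ^ a) (p ^ (i - a)) :: bit poly)"
      by (simp add: geometric_poly_mult flip: power_add)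
    then show False using q_a not_small by (metis dvd_mult2)
  qed
  then have "p ^ Suc i dvd 2 ^ degree q - 1"
    by (metis a gcd_dvd2 dvd_trans le_imp_power_dvd not_less_eq_eq)
  then have "[2 ^ degree q = 1] (mod p ^ Suc i)"
    by (subst cong_altdef_nat) simp_all
  moreover have "degree q > 0" using q(1) not_unit by (auto simp: is_unit_iff_degree)
  ultimately have "p ^ i * (p - 1) \<le> degree q"
    using residue_primroot_power_dvd_imp_le[OF p g] by blast
  also have "\<dots> \<le> degree d" using q(2) by (intro dvd_imp_degree_le) auto
  finally show ?thesis .
qed

section \<open>Recurrences as annihilating polynomials\<close>

definition apply_poly :: "'a::comm_ring_1 poly \<Rightarrow> (nat \<Rightarrow> 'a) \<Rightarrow> nat \<Rightarrow> 'a" where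
  "apply_poly P s u = (\<Sum>i\<le>degree P. coeff P i * s (u + i))"

lemma apply_poly_eq_sum:
  assumes "degree P \<le> n"
  shows "apply_poly P s u = (\<Sum>i\<le>n. coeff P i * s (u + i))"
  unfolding apply_poly_def using assms
  by (intro sum.mono_neutral_left) (auto simp: coeff_eq_0)

lemma apply_poly_0 [simp]: "apply_poly 0 s u = 0"
  by (simp add: apply_poly_def)

lemma apply_poly_zero_seq [simp]: "apply_poly P (\<lambda>_. 0) = (\<lambda>_. 0)"
  by (simp add: apply_poly_def fun_eq_iff)

lemma apply_poly_pCons: "apply_poly (pCons a P) s u = a * s u + apply_poly P s (Suc u)"
  using degree_pCons_le[of a P]
  by (simp add: apply_poly_eq_sum[of "pCons a P" "Suc (degree P)"] sum.atMost_Suc_shift apply_poly_def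
      del: sum.atMost_Suc)

lemma apply_poly_add: "apply_poly (P + Q) s u = apply_poly P s u + apply_poly Q s u"
proof -
  define n where "n = max (degree P) (degree Q)"
  have "degree P \<le> n" "degree Q \<le> n" "degree (P + Q) \<le> n"
    by (auto simp: n_def intro: degree_add_le)
  then show ?thesis
    by (simp add: apply_poly_eq_sum[of _ n] distrib_right sum.distrib)
qed

lemma apply_poly_smult: "apply_poly (smult a P) s u = a * apply_poly P s u"
  using apply_poly_eq_sum[OF degree_smult_le, of a P s u]
  by (simp add: apply_poly_def sum_distrib_left mult.assoc)

lemma apply_poly_diff: "apply_poly (P - Q) s u = apply_poly P s u - apply_poly Q s u"
  using apply_poly_add[of "P - Q" Q s u] by simp

lemma apply_poly_mult: "apply_poly (P * Q) s = apply_poly P (apply_poly Q s)"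
proof
  show "apply_poly (P * Q) s u = apply_poly P (apply_poly Q s) u" for u
    by (induction P arbitrary: u) (simp_all add: apply_poly_pCons apply_poly_add apply_poly_smult)
qed

lemma apply_poly_commute: "apply_poly P (apply_poly Q s) = apply_poly Q (apply_poly P s)"
  by (metis apply_poly_mult mult.commute)

lemma apply_poly_monom: "apply_poly (monom 1 n) s u = s (u + n)"
  by (induction n arbitrary: u) (simp_all add: monom_Suc apply_poly_pCons monom_0)

lemma apply_poly_monom_minus_1: "apply_poly (monom 1 n - 1) s u = s (u + n) - s u"
  using apply_poly_monom[of 0 s u] by (simp add: apply_poly_diff apply_poly_monom)

lemma apply_poly_geometric: "apply_poly (geometric_poly m n) s u = (\<Sum>k<n. s (u + k * m))"
  by (induction n)
    (simp_all add: geometric_poly_def apply_poly_add monom_power apply_poly_monom mult.commute)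

lemma coeff_0_geometric_poly:
  assumes "m > 0" "n > 0"
  shows "coeff (geometric_poly m n :: 'a::comm_ring_1 poly) 0 = 1"
proof -
  have "coeff (geometric_poly m n :: 'a poly) 0 = (\<Sum>k<n. if k = 0 then 1 else 0)"
    unfolding geometric_poly_def coeff_sum using assms by (intro sum.cong) (auto simp: monom_power)
  then show ?thesis using assms by simp
qed

text \<open>The annihilators of a sequence form an ideal, so the greatest common divisor of
  \<open>A\<close> and \<open>B\<close> annihilates \<open>s\<close> as well. It is nonzero because
  \<open>A\<close> is; were it constant, \<open>s\<close> would vanish.\<close>

lemma common_annihilators_imp_common_divisor:
  fixes s :: "nat \<Rightarrow> 'a::field"
  assumes "apply_poly A s = (\<lambda>_. 0)" "apply_poly B s = (\<lambda>_. 0)" "s \<noteq> (\<lambda>_. 0)" "A \<noteq> 0"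
  obtains d where "d dvd A" "d dvd B" "degree d > 0"
proof -
  obtain d v w where d: "d dvd A" "d dvd B" "d = v * A + w * B" by (rule poly_bezout)
  have "apply_poly d s u = 0" for u
    using assms(1,2) by (simp add: d(3) apply_poly_add apply_poly_mult)
  moreover have "apply_poly d s u = coeff d 0 * s u" if "degree d = 0" for u
    using that by (simp add: apply_poly_def)
  moreover have "coeff d 0 \<noteq> 0" if "degree d = 0"
    using d(1) \<open>A \<noteq> 0\<close> that leading_coeff_neq_0[of d] by auto
  ultimately show ?thesis using that d assms(3) by fastforce
qed

lemma satisfies_recurrence_imp_annihilator:
  assumes "satisfies_recurrence s L"
  obtains P where "P \<noteq> 0" "degree P = L" "apply_poly P s = (\<lambda>_. 0)"
proof -
  obtain c where c: "\<And>u. s (u + L) = (\<Sum>i<L. c i * s (u + i))"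
    using assms unfolding satisfies_recurrence_def by blast
  define P where "P = monom 1 L - (\<Sum>i<L. monom (c i) i)"
  have coeff: "coeff P i = (if i < L then - c i else if i = L then 1 else 0)" for i
  proof -
    have "(\<Sum>j<L. coeff (monom (c j) j) i) = (\<Sum>j<L. if j = i then c i else 0)"
      by (intro sum.cong) auto
    then show ?thesis by (simp add: P_def coeff_sum)
  qed
  have "P \<noteq> 0" using coeff[of L] by auto
  have "degree P \<le> L" by (rule degree_le) (simp add: coeff)
  moreover have "L \<le> degree P" by (rule le_degree) (simp add: coeff)
  ultimately have "degree P = L" by simp
  moreover have "apply_poly P s u = 0" for u
    unfolding apply_poly_def \<open>degree P = L\<close>
    by (simp add: lessThan_Suc_atMost[symmetric] coeff sum_negf c)
  ultimately show ?thesis using that \<open>P \<noteq> 0\<close> by blast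
qed

lemma annihilator_imp_satisfies_recurrence:
  fixes s :: "nat \<Rightarrow> 'a::field"
  assumes "apply_poly P s = (\<lambda>_. 0)" "coeff P 0 \<noteq> 0"
  shows "satisfies_recurrence s (degree P)"
proof -
  define c where "c i = - coeff P i / lead_coeff P" for i
  have nz: "lead_coeff P \<noteq> 0" using assms(2) by auto
  have "s (u + degree P) = (\<Sum>i<degree P. c i * s (u + i))" for u
  proof -
    have "(\<Sum>i<degree P. coeff P i * s (u + i)) + lead_coeff P * s (u + degree P) = 0"
      using fun_cong[OF assms(1), of u] by (simp add: apply_poly_def flip: lessThan_Suc_atMost)
    then have "lead_coeff P * s (u + degree P) = - (\<Sum>i<degree P. coeff P i * s (u + i))"
      by (simp add: eq_neg_iff_add_eq_0 add.commute)
    then have "s (u + degree P) = - (\<Sum>i<degree P. coeff P i * s (u + i)) / lead_coeff P"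
      using nz by (metis nonzero_eq_divide_eq mult.commute)
    then show ?thesis by (simp add: c_def sum_divide_distrib flip: sum_negf)
  qed
  moreover have "c 0 \<noteq> 0" using assms(2) nz by (simp add: c_def)
  ultimately show ?thesis unfolding satisfies_recurrence_def by blast
qed

lemma periodic_satisfies_recurrence:
  fixes s :: "nat \<Rightarrow> 'a::field"
  assumes "\<And>u. s (u + T) = s u" "T > 0"
  shows "satisfies_recurrence s T"
proof -
  have "satisfies_recurrence s (degree (monom 1 T - 1 :: 'a poly))"
    using assms by (intro annihilator_imp_satisfies_recurrence)
      (auto simp: fun_eq_iff apply_poly_monom_minus_1)
  then show ?thesis by (simp add: degree_monom_minus_1 assms)
qed

section \<open>Bounds for the error linear complexity\<close>

lemma error_linear_complexity_le:
  assumes "\<And>u. t (u + T) = t u" "card {u. u < T \<and> t u \<noteq> s u} \<le> k" "satisfies_recurrence t L"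
  shows "error_linear_complexity T k s \<le> L"
proof -
  have "error_linear_complexity T k s \<le> linear_complexity t"
    unfolding error_linear_complexity_def using assms by (intro Least_le) blast
  also have "\<dots> \<le> L" unfolding linear_complexity_def using assms(3) by (rule Least_le)
  finally show ?thesis .
qed

text \<open>Both minima are attained: \<open>s\<close> itself is an admissible sequence, and
  periodicity supplies a recurrence for each \<open>t\<close>. So it suffices to bound every
  recurrence of every admissible \<open>t\<close>.\<close>

lemma error_linear_complexity_ge:
  assumes "\<And>u. s (u + T) = s u" "T > 0"
    and "\<And>t L. (\<And>u. t (u + T) = t u) \<Longrightarrow> card {u. u < T \<and> t u \<noteq> s u} \<le> k \<Longrightarrow>
      satisfies_recurrence t L \<Longrightarrow> B \<le> L"
  shows "B \<le> error_linear_complexity T k s"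
proof -
  let ?P = "\<lambda>L. \<exists>t. (\<forall>u. t (u + T) = t u) \<and> card {u. u < T \<and> t u \<noteq> s u} \<le> k \<and>
    L = linear_complexity t"
  have "?P (linear_complexity s)" using assms(1) by (intro exI[of _ s]) simp
  then have "?P (error_linear_complexity T k s)"
    unfolding error_linear_complexity_def by (rule LeastI)
  then obtain t where t: "\<And>u. t (u + T) = t u" "card {u. u < T \<and> t u \<noteq> s u} \<le> k"
    "error_linear_complexity T k s = linear_complexity t" by blast
  have "satisfies_recurrence t (linear_complexity t)"
    unfolding linear_complexity_def
    using periodic_satisfies_recurrence[of t T, OF t(1) assms(2)] by (rule LeastI)
  then show ?thesis using assms(3)[OF t(1,2)] t(3) by simp
qed

text \<open>The sequence \<open>s = (x ^ (p ^ r) - 1) t\<close> is nonzero and is annihilated both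
  by \<Phi> and by the characteristic polynomial of the recurrence. Their nonconstant common divisor
  has the full degree of \<Phi>, so \<Phi> divides the characteristic polynomial, and the quotient
  annihilates the column sums.\<close>

lemma recurrence_of_periodic_bit_seq:
  fixes t :: "nat \<Rightarrow> bit"
  assumes p: "prime p" "odd p" and g: "residue_primroot (p ^ 2) 2"
    and per: "\<And>u. t (u + p ^ Suc r) = t u" and nper: "t (u0 + p ^ r) \<noteq> t u0"
    and L: "satisfies_recurrence t L"
  obtains P where "P \<noteq> 0" "L = p ^ r * (p - 1) + degree P"
    "apply_poly P (apply_poly (geometric_poly (p ^ r) p) t) = (\<lambda>_. 0)"
proof -
  let ?\<Phi> = "geometric_poly (p ^ r) p :: bit poly"
  define s where "s = apply_poly (monom 1 (p ^ r) - 1) t"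
  have pos: "p ^ r > 0" "p > 0" using p(1) by (auto simp: prime_gt_0_nat)
  obtain P where P: "P \<noteq> 0" "degree P = L" "apply_poly P t = (\<lambda>_. 0)"
    using satisfies_recurrence_imp_annihilator[OF L] .
  have "apply_poly P s = (\<lambda>_. 0)"
    unfolding s_def by (subst apply_poly_commute) (simp add: P)
  \<comment> \<open>The product of \<Phi> and \<open>x ^ (p ^ r) - 1\<close> is
    \<open>x ^ (p ^ (r + 1)) - 1\<close>, which annihilates \<open>t\<close>.\<close>
  moreover have "apply_poly ?\<Phi> s = (\<lambda>_. 0)"
    unfolding s_def
    by (subst apply_poly_commute)
      (simp add: fun_eq_iff geometric_poly_mult apply_poly_monom_minus_1 mult.commute[of _ p]
        per[simplified] flip: apply_poly_mult)
  moreover have "s \<noteq> (\<lambda>_. 0)"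
    using nper fun_cong[of s "\<lambda>_. 0" u0] unfolding s_def apply_poly_monom_minus_1
    by (metis eq_iff_diff_eq_0)
  ultimately obtain d where d: "d dvd P" "d dvd ?\<Phi>" "degree d > 0"
    using P(1) common_annihilators_imp_common_divisor by blast
  have deg: "degree ?\<Phi> = p ^ r * (p - 1)" and nz: "?\<Phi> \<noteq> 0"
    using degree_geometric_poly[OF pos] by auto
  have "p ^ r * (p - 1) \<le> degree d"
    using dvd_geometric_poly_bit_imp_degree_ge[OF p g, of d r 1] d by simp
  moreover obtain e where e: "?\<Phi> = d * e" using d(2) by blast
  moreover have "d \<noteq> 0" "e \<noteq> 0" using e nz by auto
  ultimately have "degree e = 0" using deg by (simp add: degree_mult_eq)
  then have "is_unit e" using \<open>e \<noteq> 0\<close> by (simp add: is_unit_iff_degree)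
  then have "?\<Phi> dvd P" using d(1) by (simp add: e mult_unit_dvd_iff)
  then obtain P' where P': "P = P' * ?\<Phi>" by (metis dvdE mult.commute)
  have "P' \<noteq> 0" using P(1) P' by auto
  then show ?thesis
    using P deg nz by (intro that[of P']) (auto simp: P' degree_mult_eq apply_poly_mult)
qed

text \<open>The difference sequence \<open>(x - 1) s\<close> is annihilated by \<open>P\<close> and
  by the quotient of \<open>x ^ (p ^ r) - 1\<close> by \<open>x - 1\<close>. Nonconstant divisors of
  this quotient have degree at least \<open>p - 1\<close>, so the difference sequence is
  zero.\<close>

lemma annihilator_small_degree_imp_constant:
  fixes s :: "nat \<Rightarrow> bit"
  assumes p: "prime p" "odd p" and g: "residue_primroot (p ^ 2) 2"
    and per: "\<And>u. s (u + p ^ r) = s u"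
    and P: "P \<noteq> 0" "apply_poly P s = (\<lambda>_. 0)" "degree P < p - 1"
  shows "s u = s 0"
proof -
  define s' where "s' = apply_poly (monom 1 1 - 1) s"
  have "apply_poly P s' = (\<lambda>_. 0)"
    unfolding s'_def by (subst apply_poly_commute) (simp add: P)
  moreover have "apply_poly (geometric_poly 1 (p ^ r)) s' = (\<lambda>_. 0)"
    unfolding s'_def
    by (subst apply_poly_commute)
      (simp add: fun_eq_iff geometric_poly_mult apply_poly_monom_minus_1 per[simplified]
        del: One_nat_def flip: apply_poly_mult)
  moreover have "\<not> (d dvd P \<and> d dvd geometric_poly 1 (p ^ r) \<and> degree d > 0)" for d
    using dvd_geometric_poly_bit_imp_degree_ge[OF p g, of d 0 r] P dvd_imp_degree_le[of d P]
    by (cases "degree d > 0") auto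
  ultimately have "s' = (\<lambda>_. 0)"
    using P(1) common_annihilators_imp_common_divisor by metis
  then have "s (Suc u) = s u" for u
    using fun_cong[of s' "\<lambda>_. 0" u] unfolding s'_def apply_poly_monom_minus_1
    by (metis eq_iff_diff_eq_0 Suc_eq_plus1)
  then show ?thesis by (induction u) auto
qed

section \<open>Digits of Euler quotients\<close>

lemma euler_quotient_exact:
  assumes "prime p" "coprime a p" "m > 0"
  shows "int p ^ m * ((int a ^ totient (p ^ m) - 1) div int p ^ m) = int a ^ totient (p ^ m) - 1"
proof -
  have "[a ^ totient (p ^ m) = 1] (mod p ^ m)"
    using assms by (intro euler_theorem) auto
  then have "int p ^ m dvd int a ^ totient (p ^ m) - 1"
    by (metis cong_iff_dvd_diff cong_int_iff of_nat_1 of_nat_power)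
  then show ?thesis by simp
qed

text \<open>Multiplied by \<open>p ^ (j + 1)\<close>, the difference of the unreduced quotients
  becomes a difference of totient powers, to which lifting the exponent applies. Reducing modulo
  \<open>p ^ (j + 1)\<close> is harmless as long as \<open>e\<close> is at most
  \<open>j + 1\<close>.\<close>

lemma euler_quotient_diff_dvd_iff:
  assumes p: "prime p" "odd p" and cop: "coprime a p" "coprime b p"
    and ab: "int p dvd int a - int b" and e: "e \<le> Suc j"
  shows "int p ^ e dvd euler_quotient p (Suc j) a - euler_quotient p (Suc j) b \<longleftrightarrow>
    int p ^ Suc e dvd int a - int b"
proof -
  define q where "q u = (int u ^ totient (p ^ Suc j) - 1) div int p ^ Suc j" for u
  have "int p ^ e dvd int p ^ Suc j" using e by (rule le_imp_power_dvd)
  then have "[x mod int p ^ Suc j = x] (mod int p ^ e)" for x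
    using cong_dvd_modulus[of "x mod int p ^ Suc j" x "int p ^ Suc j"] by (simp add: cong_def)
  then have "[euler_quotient p (Suc j) a - euler_quotient p (Suc j) b = q a - q b] (mod int p ^ e)"
    using cop by (simp add: euler_quotient_def q_def cong_diff)
  then have "int p ^ e dvd euler_quotient p (Suc j) a - euler_quotient p (Suc j) b \<longleftrightarrow>
      int p ^ e dvd q a - q b"
    by (simp add: cong_dvd_iff cong_def mod_eq_0_iff_dvd[symmetric])
  also have "\<dots> \<longleftrightarrow> int p ^ Suc j * int p ^ e dvd int p ^ Suc j * (q a - q b)"
    using p(1) by (simp add: prime_gt_0_nat)
  also have "int p ^ Suc j * (q a - q b) =
      int a ^ totient (p ^ Suc j) - int b ^ totient (p ^ Suc j)"
    unfolding right_diff_distrib q_def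
    using euler_quotient_exact[OF p(1), of _ "Suc j"] cop by simp
  also have "int p ^ Suc j * int p ^ e = int p ^ (Suc e + j)"
    by (simp add: power_add mult_ac)
  also have "int p ^ (Suc e + j) dvd int a ^ totient (p ^ Suc j) - int b ^ totient (p ^ Suc j) \<longleftrightarrow>
      int p ^ Suc e dvd int a - int b"
  proof (rule prime_power_dvd_power_totient_diff_iff[OF p ab])
    show "\<not> int p dvd int b"
      using cop(2) p(1) by (metis coprime_absorb_right int_dvd_int_iff not_prime_unit)
  qed
  finally show ?thesis .
qed

text \<open>The lower quotients of \<open>a\<close> and \<open>b\<close> agree modulo
  \<open>p ^ (j + 1)\<close>, hence are equal as reduced residues. The higher ones agree modulo
  \<open>p ^ (j + 1)\<close>, and equal digits improve this to \<open>p ^ (j + 2)\<close>, which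
  translates back to \<open>a\<close> and \<open>b\<close> with one more factor
  \<open>p\<close>.\<close>

lemma quotient_digit_eq_imp_dvd:
  assumes p: "prime p" "odd p" and cop: "coprime a p" "coprime b p"
    and ab: "int p ^ (j + 2) dvd int a - int b"
    and eq: "quotient_digit p (Suc j) a = quotient_digit p (Suc j) b"
  shows "int p ^ (j + 3) dvd int a - int b"
proof -
  define E where "E = euler_quotient p"
  define P where "P = int p ^ Suc j"
  have "P > 0" using p(1) by (simp add: P_def prime_gt_0_nat)
  have ab1: "int p dvd int a - int b"
    using ab by (rule dvd_trans[rotated]) simp
  have "P dvd E (Suc j) a - E (Suc j) b"
    using euler_quotient_diff_dvd_iff[OF p cop ab1, of "Suc j" j] ab by (simp add: E_def P_def)
  moreover have "E (Suc j) u mod P = E (Suc j) u" for u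
    using \<open>P > 0\<close> by (simp add: E_def P_def euler_quotient_def)
  ultimately have E1: "E (Suc j) a = E (Suc j) b"
    by (metis mod_eq_dvd_iff)
  have "P dvd E (Suc (Suc j)) a - E (Suc (Suc j)) b"
    using euler_quotient_diff_dvd_iff[OF p cop ab1, of "Suc j" "Suc j"] ab by (simp add: E_def P_def)
  \<comment> \<open>By \<open>E1\<close> both digits come from subtracting the same number. As
    \<open>X\<close> and \<open>Y\<close> have equal remainders modulo \<open>P\<close>, their
    difference is \<open>P\<close> times the difference of the integer quotients.\<close>
  define X Y where "X = E (Suc (Suc j)) a - E (Suc j) a" and "Y = E (Suc (Suc j)) b - E (Suc j) a"
  have XY: "X - Y = E (Suc (Suc j)) a - E (Suc (Suc j)) b" by (simp add: X_def Y_def)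
  have "X mod P = Y mod P"
    using \<open>P dvd E (Suc (Suc j)) a - _\<close> by (simp add: mod_eq_dvd_iff XY)
  then have diff: "X - Y = P * (X div P - Y div P)"
    by (simp add: minus_mod_eq_mult_div[symmetric] right_diff_distrib)
  have "(X div P) mod int p = (Y div P) mod int p"
    using eq by (simp add: X_def Y_def P_def E_def[symmetric] E1)
  then have "int p dvd X div P - Y div P" by (simp add: mod_eq_dvd_iff)
  then have "P * int p dvd X - Y" unfolding diff by (rule mult_dvd_mono[OF dvd_refl])
  then show ?thesis
    using euler_quotient_diff_dvd_iff[OF p cop ab1, of "Suc (Suc j)" "Suc j"]
    by (simp add: XY P_def E_def eval_nat_numeral mult_ac)
qed

section \<open>Columns of the class sequence\<close>

lemma coprime_add_mult_power_iff:
  fixes u k p r :: nat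
  assumes "r > 0"
  shows "coprime (u + k * p ^ r) p \<longleftrightarrow> coprime u p"
proof -
  have "[u + k * p ^ r = u] (mod p)"
    using assms by (simp add: cong_iff_dvd_diff flip: cong_int_iff)
  then show ?thesis using cong_imp_coprime cong_sym by blast
qed

lemma class_seq_periodic: "class_seq p r I (u + p ^ (r + 1)) = class_seq p r I u"
  by (simp add: class_seq_def)

lemma class_seq_not_coprime:
  assumes "p > 0" "\<not> coprime u p"
  shows "class_seq p r I u = 0"
proof -
  have "u mod p ^ (r + 1) mod p = u mod p" by (rule mod_mod_cancel) simp
  then have "\<not> coprime (u mod p ^ (r + 1)) p"
    using assms coprime_mod_left_iff[of p] by (metis less_not_refl)
  then show ?thesis by (simp add: class_seq_def digit_class_def)
qed

text \<open>Two points of a column are congruent modulo \<open>p ^ r\<close>; if their digits were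
  equal, they would be congruent modulo \<open>p ^ (r + 1)\<close> and hence coincide. So the
  \<open>p\<close> digits of a column are distinct and exhaust all \<open>p\<close> values.\<close>

lemma card_class_seq_column:
  assumes p: "prime p" "odd p" and r: "r \<ge> 2" and I: "I \<subseteq> {0..p - 1}"
    and u: "u < p ^ r" "coprime u p"
  shows "card {k. k < p \<and> class_seq p r I (u + k * p ^ r) = 1} = card I"
proof -
  obtain j where j: "r = j + 2" using r by (metis add.commute le_Suc_ex)
  define h where "h k = quotient_digit p (r - 1) (u + k * p ^ r)" for k
  have cop: "coprime (u + k * p ^ r) p" for k
    using u(2) r by (simp add: coprime_add_mult_power_iff)
  have less: "u + k * p ^ r < p ^ (r + 1)" if "k < p" for k
  proof -
    have "u + k * p ^ r < Suc k * p ^ r" using u(1) by simp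
    also have "\<dots> \<le> p * p ^ r" using that by (intro mult_right_mono) auto
    finally show ?thesis by simp
  qed
  have inj: "inj_on h {..<p}"
  proof (rule inj_onI)
    fix k l assume kl: "k \<in> {..<p}" "l \<in> {..<p}" "h k = h l"
    have diff: "int (u + k * p ^ r) - int (u + l * p ^ r) = (int k - int l) * int p ^ r"
      by (simp add: algebra_simps)
    have "int p ^ (j + 3) dvd int (u + k * p ^ r) - int (u + l * p ^ r)"
      using kl(3) diff
      by (intro quotient_digit_eq_imp_dvd[OF p cop cop]) (simp_all add: h_def j del: of_nat_add)
    then have "int p * int p ^ r dvd (int k - int l) * int p ^ r"
      unfolding diff by (simp add: j eval_nat_numeral mult_ac)
    then have "int p dvd int k - int l" using p(1) by (simp add: prime_gt_0_nat)
    then have "int k mod int p = int l mod int p" by (simp add: mod_eq_dvd_iff)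
    then show "k = l" using kl(1,2) by simp
  qed
  have pos: "int p > 0" using p(1) by (simp add: prime_gt_0_nat)
  have "h ` {..<p} \<subseteq> int ` {..<p}"
  proof safe
    fix k
    have "0 \<le> h k" "h k < int p" using pos by (simp_all add: h_def j)
    then show "h k \<in> int ` {..<p}" by (intro image_eqI[of _ _ "nat (h k)"]) auto
  qed
  then have onto: "h ` {..<p} = int ` {..<p}"
    by (intro card_subset_eq) (simp_all add: card_image inj)
  have I': "I \<subseteq> {..<p}" using I pos by auto
  have eq: "{k. k < p \<and> class_seq p r I (u + k * p ^ r) = 1} = {k \<in> {..<p}. h k \<in> int ` I}"
    using cop less by (auto simp: class_seq_def digit_class_def h_def)
  have "h ` {k \<in> {..<p}. h k \<in> int ` I} = int ` I"
    using onto I' by (auto simp: set_eq_iff image_iff) (metis imageE image_eqI lessThan_iff subsetD)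
  then have "card I = card (h ` {k \<in> {..<p}. h k \<in> int ` I})"
    by (simp add: card_image)
  also have "\<dots> = card {k \<in> {..<p}. h k \<in> int ` I}"
    by (intro card_image inj_on_subset[OF inj]) auto
  finally show ?thesis unfolding eq by simp
qed

section \<open>Counting positions column by column\<close>

lemma card_coprime_less_prime_power:
  assumes "prime p" "r > 0"
  shows "card {u. u < p ^ r \<and> \<not> coprime u p} = p ^ (r - 1)"
    and "card {u. u < p ^ r \<and> coprime u p} = p ^ (r - 1) * (p - 1)"
proof -
  obtain j where j: "r = Suc j" using assms(2) by (cases r) auto
  have pos: "p > 0" using assms(1) by (rule prime_gt_0_nat)
  have "{u. u < p ^ r \<and> \<not> coprime u p} = (*) p ` {..<p ^ (r - 1)}"
  proof (intro equalityI subsetI)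
    fix u assume u: "u \<in> {u. u < p ^ r \<and> \<not> coprime u p}"
    then have "p dvd u" using assms(1) prime_imp_coprime[of p u] by (auto simp: coprime_commute)
    then show "u \<in> (*) p ` {..<p ^ (r - 1)}" using u pos by (auto simp: j)
  qed (use pos assms(1) in \<open>auto simp: j\<close>)
  then show *: "card {u. u < p ^ r \<and> \<not> coprime u p} = p ^ (r - 1)"
    using pos by (simp add: card_image inj_on_def)
  have "card ({u. u < p ^ r \<and> \<not> coprime u p} \<union> {u. u < p ^ r \<and> coprime u p}) =
      card {u. u < p ^ r \<and> \<not> coprime u p} + card {u. u < p ^ r \<and> coprime u p}"
    by (intro card_Un_disjoint) auto
  also have "{u. u < p ^ r \<and> \<not> coprime u p} \<union> {u. u < p ^ r \<and> coprime u p} = {..<p ^ r}" by auto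
  finally show "card {u. u < p ^ r \<and> coprime u p} = p ^ (r - 1) * (p - 1)"
    using * by (simp add: j algebra_simps)
qed

lemma card_less_mult_columns:
  fixes a b :: nat
  assumes "b > 0"
  shows "card {u. u < a * b \<and> Q u} = (\<Sum>u<b. card {k. k < a \<and> Q (u + k * b)})"
proof -
  let ?S = "SIGMA u:{..<b}. {k. k < a \<and> Q (u + k * b)}"
  have "{u. u < a * b \<and> Q u} = (\<lambda>(u, k). u + k * b) ` ?S"
  proof (intro equalityI subsetI)
    fix u assume u: "u \<in> {u. u < a * b \<and> Q u}"
    then have "(u mod b, u div b) \<in> ?S" using assms by (auto simp: less_mult_imp_div_less)
    then show "u \<in> (\<lambda>(u, k). u + k * b) ` ?S" by (rule rev_image_eqI) simp
  next
    fix v assume "v \<in> (\<lambda>(u, k). u + k * b) ` ?S"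
    then obtain u k where v: "v = u + k * b" "u < b" "k < a" "Q v" by auto
    then have "v < Suc k * b" by simp
    also have "\<dots> \<le> a * b" using v by (intro mult_right_mono) auto
    finally show "v \<in> {u. u < a * b \<and> Q u}" using v by simp
  qed
  moreover have "inj_on (\<lambda>(u, k). u + k * b) ?S"
  proof (rule inj_onI, clarsimp)
    fix u k v l assume "u < b" "v < b" and eq: "u + k * b = v + l * b"
    have "u = v" using arg_cong[OF eq, of "\<lambda>x. x mod b"] \<open>u < b\<close> \<open>v < b\<close> by simp
    then show "u = v \<and> k = l" using eq assms by simp
  qed
  ultimately show ?thesis by (simp add: card_image)
qed

lemma mult_card_le_card_columns:
  fixes a b :: nat
  assumes "b > 0" "A \<subseteq> {..<b}" "\<And>u. u \<in> A \<Longrightarrow> c \<le> card {k. k < a \<and> Q (u + k * b)}"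
  shows "c * card A \<le> card {u. u < a * b \<and> Q u}"
proof -
  have "c * card A = (\<Sum>u\<in>A. c)" by simp
  also have "\<dots> \<le> (\<Sum>u\<in>A. card {k. k < a \<and> Q (u + k * b)})" using assms(3) by (rule sum_mono)
  also have "\<dots> \<le> (\<Sum>u<b. card {k. k < a \<and> Q (u + k * b)})" using assms(2) by (intro sum_mono2) auto
  finally show ?thesis using assms(1) by (simp add: card_less_mult_columns)
qed

section \<open>Error linear complexity\<close>

lemma sum_bit:
  fixes b :: "nat \<Rightarrow> bit"
  shows "(\<Sum>k<n. b k) = of_bool (odd (card {k. k < n \<and> b k = 1}))"
proof -
  have "(\<Sum>k<n. b k) = (\<Sum>k<n. if b k = 1 then 1 else 0)"
    by (intro sum.cong) auto
  also have "\<dots> = of_nat (card {k. k < n \<and> b k = 1})"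
    by (subst sum.inter_filter[symmetric]) simp_all
  finally show ?thesis by (simp add: of_nat_bit)
qed

lemma periodic_mod:
  fixes g :: "nat \<Rightarrow> 'a"
  assumes "\<And>u. g (u + m) = g u"
  shows "g u = g (u mod m)"
proof -
  have "g (v + k * m) = g v" for v k
  proof (induction k)
    case (Suc k)
    then show ?case using assms[of "v + k * m"] by (simp add: ac_simps)
  qed simp
  from this[of "u mod m" "u div m"] show ?thesis by simp
qed

locale digit_class_sequence =
  fixes p r :: nat and I :: "nat set"
  assumes prime: "prime p" and odd_p: "odd p" and primroot: "residue_primroot (p ^ 2) 2"
    and r: "r \<ge> 2"
    and I: "I \<subseteq> {0..p - 1}" "1 \<le> card I" "card I \<le> (p - 1) div 2"
begin

abbreviation f :: "nat \<Rightarrow> bit" where "f \<equiv> class_seq p r I"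

abbreviation \<Phi> :: "bit poly" where "\<Phi> \<equiv> geometric_poly (p ^ r) p"

abbreviation errors :: "(nat \<Rightarrow> bit) \<Rightarrow> nat" where
  "errors t \<equiv> card {u. u < p ^ (r + 1) \<and> t u \<noteq> f u}"

text \<open>Reduction modulo the period repeats the changes periodically. For \<open>A\<close> below
  \<open>p ^ r\<close> each column contains at most one changed position, so one error flips exactly
  one column sum.\<close>

definition flip_at :: "nat set \<Rightarrow> nat \<Rightarrow> bit" where
  "flip_at A u = f u + of_bool (u mod p ^ (r + 1) \<in> A)"

lemma p_ge_3: "p \<ge> 3"
  using prime_ge_2_nat[OF prime] odd_p by (cases "p = 2") auto

lemma pow_pos: "p ^ n > 0"
  using p_ge_3 by simp

lemma power_Suc_diff: "p ^ (r + 1) - p ^ r = p ^ r * (p - 1)"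
  by (simp add: diff_mult_distrib2 mult.commute)

lemma class_seq_column_sum:
  assumes "u < p ^ r"
  shows "apply_poly \<Phi> f u = of_bool (odd (card I) \<and> coprime u p)"
proof (cases "coprime u p")
  case True
  then show ?thesis
    using card_class_seq_column[OF prime odd_p r I(1) assms]
    by (simp add: apply_poly_geometric sum_bit)
next
  case False
  then have "f (u + k * p ^ r) = 0" for k
    using p_ge_3 r by (intro class_seq_not_coprime) (auto simp: coprime_add_mult_power_iff)
  then show ?thesis using False by (simp add: apply_poly_geometric)
qed

text \<open>The product of \<open>x ^ (p ^ r) - 1\<close> and \<Phi> is
  \<open>x ^ (p ^ (r + 1)) - 1\<close>.\<close>

lemma column_sum_periodic:
  assumes "\<And>u. t (u + p ^ (r + 1)) = t u"
  shows "apply_poly \<Phi> t (u + p ^ r) = apply_poly \<Phi> t u"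
proof -
  have "apply_poly \<Phi> t (u + p ^ r) - apply_poly \<Phi> t u =
      apply_poly (monom 1 (p ^ r) - 1) (apply_poly \<Phi> t) u"
    by (simp only: apply_poly_monom_minus_1)
  also have "\<dots> = t (u + p ^ (r + 1)) - t u"
    by (simp only: apply_poly_mult[symmetric] geometric_poly_mult apply_poly_monom_minus_1)
      (simp add: mult.commute)
  also have "\<dots> = 0" by (simp only: assms diff_self)
  finally show ?thesis by (metis eq_iff_diff_eq_0)
qed

text \<open>On a column \<open>t\<close> is constant, while \<open>f\<close> has
  \<open>card I\<close> ones if the column is coprime to \<open>p\<close>. The constant 0 costs
  \<open>card I\<close> errors there and the constant 1 costs \<open>p - card I\<close>, which is no
  less because \<open>card I\<close> is at most \<open>(p - 1) / 2\<close>.\<close>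

lemma errors_periodic_ge:
  assumes "\<And>u. t (u + p ^ r) = t u"
  shows "p ^ (r - 1) * (p - 1) * card I \<le> errors t"
proof -
  let ?A = "{u. u < p ^ r \<and> coprime u p}"
  have t: "t (u + k * p ^ r) = t u" for u k
    using periodic_mod[of t "p ^ r" "u + k * p ^ r", OF assms] periodic_mod[of t "p ^ r" u, OF assms]
    by simp
  have "card I * card ?A \<le> card {u. u < p * p ^ r \<and> t u \<noteq> f u}"
  proof (rule mult_card_le_card_columns)
    fix u assume u: "u \<in> ?A"
    let ?C = "{k. k < p \<and> f (u + k * p ^ r) = 1}"
    have C: "card ?C = card I"
      using u card_class_seq_column[OF prime odd_p r I(1)] by simp
    show "card I \<le> card {k. k < p \<and> t (u + k * p ^ r) \<noteq> f (u + k * p ^ r)}"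
    proof (cases "t u = 0")
      case True
      then have "{k. k < p \<and> t (u + k * p ^ r) \<noteq> f (u + k * p ^ r)} = ?C" by (auto simp: t)
      then show ?thesis using C by simp
    next
      case False
      then have "{k. k < p \<and> t (u + k * p ^ r) \<noteq> f (u + k * p ^ r)} = {..<p} - ?C"
        by (auto simp: t)
      moreover have "card ({..<p} - ?C) = p - card I"
        using C by (subst card_Diff_subset) auto
      ultimately show ?thesis using I(3) p_ge_3 by simp
    qed
  qed (use pow_pos in auto)
  then show ?thesis
    using card_coprime_less_prime_power(2)[OF prime, of r] r by (simp add: mult.commute)
qed

text \<open>Columns are disjoint, and each one whose sum has changed contains an error.\<close>

lemma errors_column_sum_ge:
  assumes "A \<subseteq> {..<p ^ r}" "\<And>u. u \<in> A \<Longrightarrow> apply_poly \<Phi> t u \<noteq> apply_poly \<Phi> f u"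
  shows "card A \<le> errors t"
proof -
  have "1 * card A \<le> card {u. u < p * p ^ r \<and> t u \<noteq> f u}"
  proof (rule mult_card_le_card_columns)
    fix u assume "u \<in> A"
    then have "(\<Sum>k<p. t (u + k * p ^ r)) \<noteq> (\<Sum>k<p. f (u + k * p ^ r))"
      using assms(2) by (simp only: apply_poly_geometric) blast
    then obtain k where "k < p" "t (u + k * p ^ r) \<noteq> f (u + k * p ^ r)"
      using sum.cong[OF refl, of "{..<p}" "\<lambda>k. t (u + k * p ^ r)" "\<lambda>k. f (u + k * p ^ r)"]
      by (metis lessThan_iff)
    then have "card {k. k < p \<and> t (u + k * p ^ r) \<noteq> f (u + k * p ^ r)} > 0"
      by (subst card_gt_0_iff) auto
    then show "1 \<le> card {k. k < p \<and> t (u + k * p ^ r) \<noteq> f (u + k * p ^ r)}" by linarith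
  qed (use assms(1) pow_pos in auto)
  then show ?thesis by simp
qed

lemma recurrence_few_errors:
  assumes "\<And>u. t (u + p ^ (r + 1)) = t u" "errors t < p ^ (r - 1) * (p - 1) * card I"
    and "satisfies_recurrence t L"
  obtains P where "P \<noteq> 0" "L = p ^ (r + 1) - p ^ r + degree P"
    "apply_poly P (apply_poly \<Phi> t) = (\<lambda>_. 0)"
proof -
  obtain u where "t (u + p ^ r) \<noteq> t u"
    using errors_periodic_ge[of t] assms(2) by fastforce
  then show ?thesis
    using recurrence_of_periodic_bit_seq[OF prime odd_p primroot, of t r u L] assms that
    by (metis Suc_eq_plus1 power_Suc_diff)
qed

text \<open>The product \<open>P * \<Phi>\<close> annihilates the changed sequence. Its constant
  coefficient is nonzero, as the definition of a recurrence demands.\<close>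

lemma error_linear_complexity_le_flip_at:
  assumes A: "A \<subseteq> {..<p ^ r}" "card A \<le> k"
    and P: "apply_poly P (apply_poly \<Phi> (flip_at A)) = (\<lambda>_. 0)" "coeff P 0 \<noteq> 0"
  shows "error_linear_complexity (p ^ (r + 1)) k f \<le> p ^ (r + 1) - p ^ r + degree P"
proof (rule error_linear_complexity_le)
  show "flip_at A (u + p ^ (r + 1)) = flip_at A u" for u
    unfolding flip_at_def class_seq_periodic by simp
  have "p ^ r \<le> p ^ (r + 1)" using p_ge_3 by simp
  then have "{u. u < p ^ (r + 1) \<and> flip_at A u \<noteq> f u} = A"
    using A(1) by (auto simp: flip_at_def simp del: power_Suc power_add)
  then show "errors (flip_at A) \<le> k" using A(2) by simp
  have pos: "p > 0" using p_ge_3 by simp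
  have nz: "\<Phi> \<noteq> 0" "P \<noteq> 0" and deg: "degree \<Phi> = p ^ r * (p - 1)"
    using degree_geometric_poly[OF pow_pos pos] P(2) by auto
  have "satisfies_recurrence (flip_at A) (degree (P * \<Phi>))"
    using P coeff_0_geometric_poly[OF pow_pos pos, of r, where ?'a = bit]
    by (intro annihilator_imp_satisfies_recurrence) (simp_all add: apply_poly_mult coeff_mult)
  then show "satisfies_recurrence (flip_at A) (p ^ (r + 1) - p ^ r + degree P)"
    unfolding power_Suc_diff using nz deg by (simp add: degree_mult_eq add.commute)
qed

lemma flip_at_column_sum:
  assumes A: "A \<subseteq> {..<p ^ r}"
  shows "apply_poly \<Phi> (flip_at A) u =
    of_bool (odd (card I) \<and> coprime (u mod p ^ r) p) + of_bool (u mod p ^ r \<in> A)"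
proof -
  let ?v = "u mod p ^ r"
  have v: "?v < p ^ r" using pow_pos by simp
  \<comment> \<open>Since \<open>A\<close> lies below \<open>p ^ r\<close>, only the first point
    \<open>k = 0\<close> of the column can belong to it.\<close>
  have "(\<Sum>k<p. of_bool ((?v + k * p ^ r) mod p ^ (r + 1) \<in> A)) =
      (\<Sum>k<p. if k = 0 then of_bool (?v \<in> A) else 0 :: bit)"
  proof (intro sum.cong refl)
    fix k assume k: "k \<in> {..<p}"
    have "?v + k * p ^ r < Suc k * p ^ r" using v by simp
    also have "\<dots> \<le> p * p ^ r" using k by (intro mult_right_mono) auto
    finally have "(?v + k * p ^ r) mod p ^ (r + 1) = ?v + k * p ^ r" by simp
    moreover have "?v + k * p ^ r \<notin> A" if "k > 0"
    proof
      assume "?v + k * p ^ r \<in> A"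
      then have "?v + k * p ^ r < p ^ r" using A by blast
      moreover have "1 * p ^ r \<le> k * p ^ r" using that by (intro mult_right_mono) auto
      ultimately show False by linarith
    qed
    ultimately show "of_bool ((?v + k * p ^ r) mod p ^ (r + 1) \<in> A) =
      (if k = 0 then of_bool (?v \<in> A) else 0 :: bit)" by auto
  qed
  also have "\<dots> = of_bool (?v \<in> A)" using p_ge_3 by simp
  finally have "apply_poly \<Phi> (flip_at A) ?v = apply_poly \<Phi> f ?v + of_bool (?v \<in> A)"
    by (simp only: apply_poly_geometric flip_at_def sum.distrib)
  moreover have "apply_poly \<Phi> (flip_at A) u = apply_poly \<Phi> (flip_at A) ?v"
    by (intro periodic_mod column_sum_periodic) (simp only: flip_at_def class_seq_periodic mod_add_self2)
  ultimately show ?thesis using class_seq_column_sum[OF v] by simp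
qed

text \<open>Below the threshold the factor \<Phi> always splits off, so a lower bound only has to
  control the degree of annihilators of the column sums.\<close>

lemma error_linear_complexity_ge_base:
  assumes "k < p ^ (r - 1) * (p - 1) * card I"
    and "\<And>t P. (\<And>u. t (u + p ^ (r + 1)) = t u) \<Longrightarrow> errors t \<le> k \<Longrightarrow> P \<noteq> 0 \<Longrightarrow>
      apply_poly P (apply_poly \<Phi> t) = (\<lambda>_. 0) \<Longrightarrow> e \<le> degree P"
  shows "p ^ (r + 1) - p ^ r + e \<le> error_linear_complexity (p ^ (r + 1)) k f"
proof (rule error_linear_complexity_ge)
  fix t L
  assume t: "\<And>u. t (u + p ^ (r + 1)) = t u" "errors t \<le> k" "satisfies_recurrence t L"
  then obtain P where "P \<noteq> 0" "L = p ^ (r + 1) - p ^ r + degree P"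
    "apply_poly P (apply_poly \<Phi> t) = (\<lambda>_. 0)"
    using recurrence_few_errors[of t L] assms(1) by auto
  then show "p ^ (r + 1) - p ^ r + e \<le> L" using assms(2)[OF t(1,2)] by simp
qed (simp_all only: class_seq_periodic pow_pos)

text \<open>The threshold is the number of ones of \<open>f\<close> in a period, so the zero
  sequence is admissible.\<close>

lemma error_linear_complexity_eq_0:
  assumes "p ^ (r - 1) * (p - 1) * card I \<le> k"
  shows "error_linear_complexity (p ^ (r + 1)) k f = 0"
proof -
  have "card {k. k < p \<and> 0 \<noteq> f (u + k * p ^ r)} = (if coprime u p then card I else 0)"
    if "u < p ^ r" for u
  proof (cases "coprime u p")
    case True
    have "{k. k < p \<and> 0 \<noteq> f (u + k * p ^ r)} = {k. k < p \<and> f (u + k * p ^ r) = 1}" by auto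
    then show ?thesis
      using True card_class_seq_column[OF prime odd_p r I(1) that] by simp
  next
    case False
    then have "f (u + k * p ^ r) = 0" for k
      using p_ge_3 r by (intro class_seq_not_coprime) (auto simp: coprime_add_mult_power_iff)
    then show ?thesis using False by simp
  qed
  then have "card {u. u < p * p ^ r \<and> 0 \<noteq> f u} = (\<Sum>u<p ^ r. if coprime u p then card I else 0)"
    using card_less_mult_columns[OF pow_pos, of p r "\<lambda>u. 0 \<noteq> f u"] by simp
  also have "\<dots> = card {u. u < p ^ r \<and> coprime u p} * card I"
    by (simp add: sum.If_cases Int_def)
  also have "\<dots> = p ^ (r - 1) * (p - 1) * card I"
    using card_coprime_less_prime_power(2)[OF prime, of r] r by simp
  finally have "errors (\<lambda>_. 0) \<le> k" using assms by simp
  moreover have "satisfies_recurrence (\<lambda>_. 0 :: bit) 0"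
    by (simp add: satisfies_recurrence_def)
  ultimately have "error_linear_complexity (p ^ (r + 1)) k f \<le> 0"
    by (intro error_linear_complexity_le[of "\<lambda>_. 0"]) auto
  then show ?thesis by simp
qed

lemma error_linear_complexity_even:
  assumes "even (card I)" "k < p ^ (r - 1) * (p - 1) * card I"
  shows "error_linear_complexity (p ^ (r + 1)) k f = p ^ (r + 1) - p ^ r"
proof (rule antisym)
  have "apply_poly \<Phi> (flip_at {}) = (\<lambda>_. 0)" using assms(1) by (simp add: flip_at_column_sum fun_eq_iff)
  then show "error_linear_complexity (p ^ (r + 1)) k f \<le> p ^ (r + 1) - p ^ r"
    using error_linear_complexity_le_flip_at[of "{}" k 1] by simp
  show "p ^ (r + 1) - p ^ r \<le> error_linear_complexity (p ^ (r + 1)) k f"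
    using error_linear_complexity_ge_base[OF assms(2), of 0] by simp
qed

section \<open>Odd number of digit classes\<close>

context
  assumes odd_I: "odd (card I)"
begin

lemma zero_column_sum_errors_ge:
  assumes "apply_poly \<Phi> t = (\<lambda>_. 0)"
  shows "p ^ (r - 1) * (p - 1) \<le> errors t"
proof -
  have "card {u. u < p ^ r \<and> coprime u p} \<le> errors t"
    using odd_I assms by (intro errors_column_sum_ge) (auto simp: class_seq_column_sum)
  then show ?thesis
    using card_coprime_less_prime_power(2)[OF prime, of r] r by simp
qed

text \<open>The constant 0 requires a change in every coprime column, the constant 1 a change in
  each of the \<open>p ^ (r - 1)\<close> other columns.\<close>

lemma constant_column_sum_errors_ge:
  assumes "\<And>u. apply_poly \<Phi> t u = apply_poly \<Phi> t 0"
  shows "p ^ (r - 1) \<le> errors t"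
proof (cases "apply_poly \<Phi> t 0 = 0")
  case True
  then have "p ^ (r - 1) * (p - 1) \<le> errors t"
    using assms by (intro zero_column_sum_errors_ge) (auto simp: fun_eq_iff)
  moreover have "p ^ (r - 1) * 1 \<le> p ^ (r - 1) * (p - 1)"
    using p_ge_3 by (intro mult_left_mono) auto
  ultimately show ?thesis by linarith
next
  case False
  have "card {u. u < p ^ r \<and> \<not> coprime u p} \<le> errors t"
  proof (rule errors_column_sum_ge)
    show "apply_poly \<Phi> t u \<noteq> apply_poly \<Phi> f u" if "u \<in> {u. u < p ^ r \<and> \<not> coprime u p}" for u
      using False assms[of u] that by (simp add: class_seq_column_sum)
  qed auto
  then show ?thesis
    using card_coprime_less_prime_power(1)[OF prime, of r] r by simp
qed

text \<open>The column sums of \<open>f\<close> itself have period \<open>p\<close> with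
  \<open>p - 1\<close> ones per period, an even number, so \<open>1 + x + ... + x ^ (p - 1)\<close>
  annihilates them. An annihilator of smaller degree would make the column sums of an admissible
  sequence constant, which takes \<open>p ^ (r - 1)\<close> errors.\<close>

lemma error_linear_complexity_odd_1:
  assumes "k < p ^ (r - 1)"
  shows "error_linear_complexity (p ^ (r + 1)) k f = p ^ (r + 1) - p ^ r + (p - 1)"
proof (rule antisym)
  define g where "g = apply_poly \<Phi> (flip_at {})"
  have g: "g u = of_bool (coprime (u mod p ^ r) p)" for u
    unfolding g_def using flip_at_column_sum[of "{}"] odd_I by simp
  have "p dvd p ^ r" using r by simp
  then have g': "g u = of_bool (coprime u p)" for u
    unfolding g using coprime_mod_left_iff[of p "u mod p ^ r"] coprime_mod_left_iff[of p u] p_ge_3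
    by (simp add: mod_mod_cancel)
  let ?\<Psi> = "geometric_poly 1 p :: bit poly"
  have h: "apply_poly ?\<Psi> g u = 0" for u
  \<comment> \<open>Only the sum at 0 is computed; the others equal it because
    \<open>(x - 1) * ?\<Psi>\<close> is \<open>x ^ p - 1\<close> and \<open>g\<close> has period
    \<open>p\<close>.\<close>
  proof (induction u)
    case 0
    have "coprime k p \<longleftrightarrow> k > 0" if "k < p" for k
      using that prime prime_imp_coprime[of p k] nat_dvd_not_less[of k p] p_ge_3
      by (cases "k = 0") (auto simp: coprime_commute)
    then have "{k. k < p \<and> g k = 1} = {0<..<p}" by (auto simp: g')
    then have "card {k. k < p \<and> g k = 1} = p - 1" by simp
    then show ?case using odd_p p_ge_3 unfolding apply_poly_geometric by (simp add: sum_bit)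
  next
    case (Suc u)
    have "apply_poly ?\<Psi> g (u + 1) - apply_poly ?\<Psi> g u =
        apply_poly (monom 1 1 - 1) (apply_poly ?\<Psi> g) u"
      by (simp only: apply_poly_monom_minus_1)
    also have "\<dots> = g (u + p) - g u"
      by (simp only: apply_poly_mult[symmetric] geometric_poly_mult apply_poly_monom_minus_1 mult_1)
    also have "\<dots> = 0"
      using coprime_add_mult_power_iff[of 1 u 1 p] unfolding g' by (simp del: minus_bit_def)
    finally show ?case using Suc by (simp del: minus_bit_def)
  qed
  have pos: "p > 0" using p_ge_3 by simp
  have "error_linear_complexity (p ^ (r + 1)) k f \<le> p ^ (r + 1) - p ^ r + degree ?\<Psi>"
    using h coeff_0_geometric_poly[of 1 p, where ?'a = bit] pos
    by (intro error_linear_complexity_le_flip_at[of "{}"]) (auto simp: g_def)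
  then show "error_linear_complexity (p ^ (r + 1)) k f \<le> p ^ (r + 1) - p ^ r + (p - 1)"
    using degree_geometric_poly(1)[of 1 p, where ?'a = bit] pos by simp
next
  have "p ^ (r - 1) * (1 * 1) \<le> p ^ (r - 1) * ((p - 1) * card I)"
    using p_ge_3 I(2) by (intro mult_left_mono mult_mono) auto
  then have "k < p ^ (r - 1) * ((p - 1) * card I)" using assms by linarith
  then have "k < p ^ (r - 1) * (p - 1) * card I" by (simp only: mult.assoc)
  then show "p ^ (r + 1) - p ^ r + (p - 1) \<le> error_linear_complexity (p ^ (r + 1)) k f"
  proof (rule error_linear_complexity_ge_base)
    fix t :: "nat \<Rightarrow> bit" and P
    assume t: "\<And>u. t (u + p ^ (r + 1)) = t u" "errors t \<le> k"
      and P: "P \<noteq> 0" "apply_poly P (apply_poly \<Phi> t) = (\<lambda>_. 0)"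
    show "p - 1 \<le> degree P"
    proof (rule ccontr)
      assume "\<not> p - 1 \<le> degree P"
      then have "apply_poly \<Phi> t u = apply_poly \<Phi> t 0" for u
        using annihilator_small_degree_imp_constant[OF prime odd_p primroot, of "apply_poly \<Phi> t" r P]
          column_sum_periodic[of t, OF t(1)] P by simp
      then show False using constant_column_sum_errors_ge[of t] t(2) assms by simp
    qed
  qed
qed

text \<open>Flipping the \<open>p ^ (r - 1)\<close> multiples of \<open>p\<close> below
  \<open>p ^ r\<close> makes every column sum 1, and \<open>x - 1\<close> annihilates a constant. A
  constant nonzero annihilator would need all column sums to vanish, which is too expensive.\<close>

lemma error_linear_complexity_odd_2:
  assumes "p ^ (r - 1) \<le> k" "k < p ^ (r - 1) * (p - 1)"
  shows "error_linear_complexity (p ^ (r + 1)) k f = p ^ (r + 1) - p ^ r + 1"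
proof (rule antisym)
  let ?A = "{u. u < p ^ r \<and> \<not> coprime u p}"
  have "apply_poly \<Phi> (flip_at ?A) u = 1" for u
    using odd_I pow_pos by (subst flip_at_column_sum) auto
  then have "apply_poly (monom 1 1 - 1) (apply_poly \<Phi> (flip_at ?A)) = (\<lambda>_. 0)"
    by (simp only: fun_eq_iff apply_poly_monom_minus_1 diff_self simp_thms)
  then have "error_linear_complexity (p ^ (r + 1)) k f \<le>
      p ^ (r + 1) - p ^ r + degree (monom 1 1 - 1 :: bit poly)"
    using card_coprime_less_prime_power(1)[OF prime, of r] r assms(1)
    by (intro error_linear_complexity_le_flip_at[of ?A]) auto
  then show "error_linear_complexity (p ^ (r + 1)) k f \<le> p ^ (r + 1) - p ^ r + 1"
    by (simp only: degree_monom_minus_1 zero_less_one)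
next
  have "p ^ (r - 1) * (p - 1) * 1 \<le> p ^ (r - 1) * (p - 1) * card I"
    using I(2) by (intro mult_left_mono) auto
  then have "k < p ^ (r - 1) * (p - 1) * card I" using assms by linarith
  then show "p ^ (r + 1) - p ^ r + 1 \<le> error_linear_complexity (p ^ (r + 1)) k f"
  proof (rule error_linear_complexity_ge_base)
    fix t :: "nat \<Rightarrow> bit" and P
    assume t: "\<And>u. t (u + p ^ (r + 1)) = t u" "errors t \<le> k"
      and P: "P \<noteq> 0" "apply_poly P (apply_poly \<Phi> t) = (\<lambda>_. 0)"
    show "1 \<le> degree P"
    proof (rule ccontr)
      assume "\<not> 1 \<le> degree P"
      then have "degree P = 0" by simp
      then obtain c where "P = [:c:]" by (rule degree_eq_zeroE)
      then have "apply_poly \<Phi> t = (\<lambda>_. 0)"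
        using P by (auto simp: fun_eq_iff apply_poly_pCons)
      then show False using zero_column_sum_errors_ge[of t] t(2) assms(2) by simp
    qed
  qed
qed

text \<open>One flip in each coprime column makes all column sums vanish, so the constant polynomial
  1 annihilates them and only \<Phi> remains.\<close>

lemma error_linear_complexity_odd_3:
  assumes "p ^ (r - 1) * (p - 1) \<le> k" "k < p ^ (r - 1) * (p - 1) * card I"
  shows "error_linear_complexity (p ^ (r + 1)) k f = p ^ (r + 1) - p ^ r"
proof (rule antisym)
  let ?A = "{u. u < p ^ r \<and> coprime u p}"
  have "apply_poly \<Phi> (flip_at ?A) = (\<lambda>_. 0)"
    using odd_I pow_pos by (subst fun_eq_iff, subst flip_at_column_sum) auto
  then show "error_linear_complexity (p ^ (r + 1)) k f \<le> p ^ (r + 1) - p ^ r"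
    using error_linear_complexity_le_flip_at[of ?A k 1] assms(1)
      card_coprime_less_prime_power(2)[OF prime, of r] r by auto
  show "p ^ (r + 1) - p ^ r \<le> error_linear_complexity (p ^ (r + 1)) k f"
    using error_linear_complexity_ge_base[OF assms(2), of 0] by simp
qed

end

end

theorem theorem4:
  fixes p r k :: nat and I :: "nat set"
  assumes "prime p" and "odd p" and "residue_primroot (p ^ 2) 2"
    and "r \<ge> 2"
    and "I \<subseteq> {0..p - 1}" and "1 \<le> card I" and "card I \<le> (p - 1) div 2"
  shows "(odd (card I) \<longrightarrow>
            (k < p ^ (r - 1) \<longrightarrow>
               error_linear_complexity (p ^ (r + 1)) k (class_seq p r I)
                 = p ^ (r + 1) - p ^ r + p - 1) \<and>
            (p ^ (r - 1) \<le> k \<and> k < p ^ (r - 1) * (p - 1) \<longrightarrow>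
               error_linear_complexity (p ^ (r + 1)) k (class_seq p r I)
                 = p ^ (r + 1) - p ^ r + 1) \<and>
            (p ^ (r - 1) * (p - 1) \<le> k \<and> k < p ^ (r - 1) * (p - 1) * card I \<longrightarrow>
               error_linear_complexity (p ^ (r + 1)) k (class_seq p r I)
                 = p ^ (r + 1) - p ^ r) \<and>
            (p ^ (r - 1) * (p - 1) * card I \<le> k \<longrightarrow>
               error_linear_complexity (p ^ (r + 1)) k (class_seq p r I) = 0)) \<and>
         (even (card I) \<longrightarrow>
            (k < p ^ (r - 1) * (p - 1) * card I \<longrightarrow>
               error_linear_complexity (p ^ (r + 1)) k (class_seq p r I)
                 = p ^ (r + 1) - p ^ r) \<and>
            (p ^ (r - 1) * (p - 1) * card I \<le> k \<longrightarrow>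
               error_linear_complexity (p ^ (r + 1)) k (class_seq p r I) = 0))"
proof -
  interpret digit_class_sequence p r I
    using assms by unfold_locales
  \<comment> \<open>Subtraction on the natural numbers is truncated; regrouping is valid because
    \<open>p\<close> is at least 1.\<close>
  have eq: "p ^ (r + 1) - p ^ r + p - 1 = p ^ (r + 1) - p ^ r + (p - 1)"
    using p_ge_3 by simp
  show ?thesis
    unfolding eq
    using error_linear_complexity_odd_1 error_linear_complexity_odd_2 error_linear_complexity_odd_3
      error_linear_complexity_even error_linear_complexity_eq_0 by blast
qed

end
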